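(* The graph $C_{13}(3,4)$ has no quantum symmetry, i.e. the $C^*$-algebra $A(C_{13}(3,4))$ is commutative.
   Context: $C_{13}(3,4)$ is the graph with vertex set $\mathbb{Z}/13\mathbb{Z}=\{0,1,\dots,12\}$ in which $i\sim j$ if and only if $i-j \bmod 13\in\{\pm1,\pm3,\pm4\}$. A matrix $u=(u_{ij})$ with entries in a unital $C^*$-algebra is magic unitary if all its entries are projections, distinct entries in the same row or the same column are orthogonal, and each row and each column sums to $1$. $A_s(n)$ is the universal unital $C^*$-algebra generated by $n^2$ elements $u_{ij}$ subject to the relations making $u=(u_{ij})$ magic unitary. For a finite graph $X$ with $n$ vertices and adjacency matrix $d_X\in M_n(\{0,1\})$, $A(X)=A_s(n)/\langle d_Xu=ud_X\rangle$ is the quotient by the relations that $d_X$ commutes with $u$. $X$ has no quantum symmetry if $A(X)$ is commutative (equivalently $A(X)=C(\mathrm{Aut}(X))$). *)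

theory Defs
  imports
    Complex_Main
    "HOL-Algebra.Module"
    "HOL-Algebra.QuotRing"
    "HOL-Library.Poly_Mapping"
    "HOL-Library.Numeral_Type"
begin

text \<open>Words in the generators and their formal adjoints, under concatenation.\<close>

datatype 'g letter = Gen 'g | Adj 'g

datatype 'g star_word = Word "'g letter list"

fun letters :: "'g star_word \<Rightarrow> 'g letter list" where
  "letters (Word ws) = ws"

instantiation star_word :: (type) monoid_add
begin

definition zero_star_word :: "'a star_word" where
  "zero_star_word = Word []"

definition plus_star_word :: "'a star_word \<Rightarrow> 'a star_word \<Rightarrow> 'a star_word" where
  "plus_star_word v w = Word (letters v @ letters w)"

instance
proof
  fix a b c :: "'a star_word"
  show "a + b + c = a + (b + c)" by (simp add: plus_star_word_def)
  show "0 + a = a" by (cases a) (simp add: plus_star_word_def zero_star_word_def)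
  show "a + 0 = a" by (cases a) (simp add: plus_star_word_def zero_star_word_def)
qed

end

fun adj_letter :: "'g letter \<Rightarrow> 'g letter" where
  "adj_letter (Gen g) = Adj g"
| "adj_letter (Adj g) = Gen g"

definition adj_word :: "'g star_word \<Rightarrow> 'g star_word" where
  "adj_word w = Word (rev (map adj_letter (letters w)))"

text \<open>The free unital complex *-algebra on a set of generators. Its ring structure is the
  convolution product of \<^theory>\<open>HOL-Library.Poly_Mapping\<close>.\<close>

type_synonym 'g free_star_algebra = "'g star_word \<Rightarrow>\<^sub>0 complex"

definition free_gen :: "'g \<Rightarrow> 'g free_star_algebra" where
  "free_gen g = Poly_Mapping.single (Word [Gen g]) 1"

definition free_scale :: "complex \<Rightarrow> 'g free_star_algebra \<Rightarrow> 'g free_star_algebra" where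
  "free_scale c x = Poly_Mapping.single 0 c * x"

definition free_star :: "'g free_star_algebra \<Rightarrow> 'g free_star_algebra" where
  "free_star x = (\<Sum>w\<in>Poly_Mapping.keys x.
     Poly_Mapping.single (adj_word w) (cnj (Poly_Mapping.lookup x w)))"

definition cstar_seminorm :: "('g free_star_algebra \<Rightarrow> real) \<Rightarrow> bool" where
  "cstar_seminorm p \<longleftrightarrow>
     (\<forall>x y. p (x + y) \<le> p x + p y) \<and>
     (\<forall>c x. p (free_scale c x) = cmod c * p x) \<and>
     (\<forall>x y. p (x * y) \<le> p x * p y) \<and>
     (\<forall>x. p (free_star x * x) = (p x)\<^sup>2)"

text \<open>The C*-seminorms annihilating \<open>R\<close> are exactly the functions \<open>x \<mapsto> \<parallel>\<pi> x\<parallel>\<close>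
  for *-homomorphisms \<open>\<pi>\<close> from the free algebra to C*-algebras in which the elements of \<open>R\<close>
  become zero. The universal C*-algebra with relations \<open>R\<close> is the Hausdorff completion of the
  free algebra in the largest of these seminorms. It exists when \<open>bounded_relations R\<close> holds;
  otherwise the supremum below has no meaning.\<close>

definition relation_seminorms :: "'g free_star_algebra set \<Rightarrow> ('g free_star_algebra \<Rightarrow> real) set" where
  "relation_seminorms R = {p. cstar_seminorm p \<and> (\<forall>r\<in>R. p r = 0)}"

definition bounded_relations :: "'g free_star_algebra set \<Rightarrow> bool" where
  "bounded_relations R \<longleftrightarrow> (\<forall>x. bdd_above ((\<lambda>p. p x) ` relation_seminorms R))"

definition universal_seminorm :: "'g free_star_algebra set \<Rightarrow> 'g free_star_algebra \<Rightarrow> real" where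
  "universal_seminorm R x = (SUP p\<in>relation_seminorms R. p x)"

record 'a normed_star_algebra = "(complex, 'a) module" +
  star :: "'a \<Rightarrow> 'a"
  nrm :: "'a \<Rightarrow> real"

text \<open>Quotient by a two-sided ideal closed under \<^const>\<open>star\<close>. The operations are those induced on
  cosets, and the norm is the quotient norm.\<close>

definition quotient_algebra ::
  "'a normed_star_algebra \<Rightarrow> 'a set \<Rightarrow> 'a set normed_star_algebra" where
  "quotient_algebra A I =
    \<lparr>carrier = carrier (A Quot I),
     mult = mult (A Quot I),
     one = one (A Quot I),
     zero = zero (A Quot I),
     add = add (A Quot I),
     smult = (\<lambda>c X. \<Union>x\<in>X. I +>\<^bsub>A\<^esub> (c \<odot>\<^bsub>A\<^esub> x)),
     star = (\<lambda>X. \<Union>x\<in>X. I +>\<^bsub>A\<^esub> star A x),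
     nrm = (\<lambda>X. INF x\<in>X. nrm A x)\<rparr>"

definition cauchy_for :: "('a::ab_group_add \<Rightarrow> real) \<Rightarrow> (nat \<Rightarrow> 'a) \<Rightarrow> bool" where
  "cauchy_for p s \<longleftrightarrow> (\<forall>e>0. \<exists>N. \<forall>m\<ge>N. \<forall>n\<ge>N. p (s m - s n) < e)"

definition cauchy_algebra ::
  "('g free_star_algebra \<Rightarrow> real) \<Rightarrow> (nat \<Rightarrow> 'g free_star_algebra) normed_star_algebra" where
  "cauchy_algebra p =
    \<lparr>carrier = {s. cauchy_for p s},
     mult = (\<lambda>s t n. s n * t n),
     one = (\<lambda>n. 1),
     zero = (\<lambda>n. 0),
     add = (\<lambda>s t n. s n + t n),
     smult = (\<lambda>c s n. free_scale c (s n)),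
     star = (\<lambda>s n. free_star (s n)),
     nrm = (\<lambda>s. lim (\<lambda>n. p (s n)))\<rparr>"

definition null_ideal :: "'a normed_star_algebra \<Rightarrow> 'a set" where
  "null_ideal A = {x \<in> carrier A. nrm A x = 0}"

definition universal_cstar_algebra ::
  "'g free_star_algebra set \<Rightarrow> (nat \<Rightarrow> 'g free_star_algebra) set normed_star_algebra" where
  "universal_cstar_algebra R =
     (let C = cauchy_algebra (universal_seminorm R) in quotient_algebra C (null_ideal C))"

definition universal_gen ::
  "'g free_star_algebra set \<Rightarrow> 'g \<Rightarrow> (nat \<Rightarrow> 'g free_star_algebra) set" where
  "universal_gen R g =
     (let C = cauchy_algebra (universal_seminorm R) in null_ideal C +>\<^bsub>C\<^esub> (\<lambda>n. free_gen g))"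

definition closed_ideal :: "'a normed_star_algebra \<Rightarrow> 'a set \<Rightarrow> bool" where
  "closed_ideal A I \<longleftrightarrow> ideal I A \<and>
     (\<forall>x\<in>carrier A. (\<forall>e>0. \<exists>y\<in>I. nrm A (x \<ominus>\<^bsub>A\<^esub> y) < e) \<longrightarrow> x \<in> I)"

definition generated_closed_ideal :: "'a normed_star_algebra \<Rightarrow> 'a set \<Rightarrow> 'a set" where
  "generated_closed_ideal A S = \<Inter>{I. closed_ideal A I \<and> S \<subseteq> I}"

text \<open>Rows and columns are indexed by a finite type \<open>'v\<close>, so that \<open>n = CARD('v)\<close>.\<close>

definition magic_relations :: "('v::finite \<times> 'v) free_star_algebra set" where
  "magic_relations = (let u = (\<lambda>i j. free_gen (i, j)) in
     {free_star (u i j) - u i j | i j. True} \<union>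
     {u i j * u i j - u i j | i j. True} \<union>
     {u i j * u i k | i j k. j \<noteq> k} \<union>
     {u i k * u j k | i j k. i \<noteq> j} \<union>
     {(\<Sum>j\<in>UNIV. u i j) - 1 | i. True} \<union>
     {(\<Sum>i\<in>UNIV. u i j) - 1 | j. True})"

type_synonym 'v magic_element = "(nat \<Rightarrow> ('v \<times> 'v) free_star_algebra) set"

definition A_s :: "'v::finite magic_element normed_star_algebra" where
  "A_s = universal_cstar_algebra magic_relations"

definition magic_gen :: "'v::finite \<Rightarrow> 'v \<Rightarrow> 'v magic_element" where
  "magic_gen i j = universal_gen magic_relations (i, j)"

text \<open>A finite graph on the vertex set \<open>'v\<close> is given by its adjacency relation.\<close>

definition adjacency_matrix :: "('v \<Rightarrow> 'v \<Rightarrow> bool) \<Rightarrow> 'v \<Rightarrow> 'v \<Rightarrow> complex" where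
  "adjacency_matrix E i j = (if E i j then 1 else 0)"

definition commutation_relations :: "('v::finite \<Rightarrow> 'v \<Rightarrow> bool) \<Rightarrow> 'v magic_element set" where
  "commutation_relations E = (let d = adjacency_matrix E; u = magic_gen in
     {(\<Oplus>\<^bsub>A_s\<^esub>k\<in>UNIV. d i k \<odot>\<^bsub>A_s\<^esub> u k j) \<ominus>\<^bsub>A_s\<^esub> (\<Oplus>\<^bsub>A_s\<^esub>k\<in>UNIV. d k j \<odot>\<^bsub>A_s\<^esub> u i k)
      | i j. True})"

definition quantum_automorphism_algebra ::
  "('v::finite \<Rightarrow> 'v \<Rightarrow> bool) \<Rightarrow> 'v magic_element set normed_star_algebra" where
  "quantum_automorphism_algebra E =
     quotient_algebra A_s (generated_closed_ideal A_s (commutation_relations E))"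

definition no_quantum_symmetry :: "('v::finite \<Rightarrow> 'v \<Rightarrow> bool) \<Rightarrow> bool" where
  "no_quantum_symmetry E \<longleftrightarrow> (let A = quantum_automorphism_algebra E in
     \<forall>x\<in>carrier A. \<forall>y\<in>carrier A. x \<otimes>\<^bsub>A\<^esub> y = y \<otimes>\<^bsub>A\<^esub> x)"

text \<open>The type \<open>13\<close> carries the ring structure of the integers modulo 13.\<close>

definition C13_3_4 :: "13 \<Rightarrow> 13 \<Rightarrow> bool" where
  "C13_3_4 i j \<longleftrightarrow> i - j \<in> {1, -1, 3, -3, 4, -4}"

text \<open>The construction is meaningful: the magic relations are bounded, so that the universal
  seminorm is indeed the largest admissible C*-seminorm, and the two quotients are taken by
  ideals, so that both algebras are rings.\<close>

lemma free_star_gen: "free_star (free_gen g) = Poly_Mapping.single (Word [Adj g]) 1"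
  by (simp add: free_star_def free_gen_def adj_word_def)

lemma free_star_one: "free_star 1 = 1"
  by (simp add: free_star_def adj_word_def zero_star_word_def flip: single_one)

context
  fixes p :: "'g free_star_algebra \<Rightarrow> real"
  assumes p: "cstar_seminorm p"
begin

lemma cstar_seminorm_triangle: "p (x + y) \<le> p x + p y"
  and cstar_seminorm_scale: "p (free_scale c x) = cmod c * p x"
  and cstar_seminorm_mult: "p (x * y) \<le> p x * p y"
  and cstar_seminorm_star: "p (free_star x * x) = (p x)\<^sup>2"
  using p unfolding cstar_seminorm_def by blast+

lemma cstar_seminorm_zero: "p 0 = 0"
  using cstar_seminorm_scale[of 0 0] by (simp add: free_scale_def)

lemma cstar_seminorm_uminus: "p (- x) = p x"
proof -
  have "free_scale (-1) x = - x"
    by (simp add: free_scale_def single_uminus)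
  then show ?thesis using cstar_seminorm_scale[of "-1" x] by simp
qed

lemma cstar_seminorm_nonneg: "0 \<le> p x"
  using cstar_seminorm_triangle[of x "-x"] by (simp add: cstar_seminorm_zero cstar_seminorm_uminus)

lemma cstar_seminorm_diff: "p (x - y) \<le> p x + p y"
  using cstar_seminorm_triangle[of x "-y"] by (simp add: cstar_seminorm_uminus)

lemma cstar_seminorm_reverse: "\<bar>p x - p y\<bar> \<le> p (x - y)"
  using cstar_seminorm_triangle[of "x - y" y] cstar_seminorm_triangle[of "y - x" x]
    cstar_seminorm_uminus[of "x - y"] by simp

lemma cstar_seminorm_sum: "p (\<Sum>i\<in>S. f i) \<le> (\<Sum>i\<in>S. p (f i))"
proof (induction S rule: infinite_finite_induct)
  case (insert i S)
  then show ?case using cstar_seminorm_triangle[of "f i" "\<Sum>i\<in>S. f i"] by simp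
qed (simp_all add: cstar_seminorm_zero)

lemma cstar_seminorm_one_le: "p 1 \<le> 1"
proof -
  have "p 1 = (p 1)\<^sup>2" using cstar_seminorm_star[of 1] by (simp add: free_star_one)
  then show ?thesis by (metis order_refl power2_eq_square mult_cancel_left2 zero_le_one)
qed

lemma cstar_seminorm_word_le:
  assumes "\<And>a. p (Poly_Mapping.single (Word [a]) 1) \<le> 1"
  shows "p (Poly_Mapping.single w 1) \<le> 1"
proof -
  have "p (Poly_Mapping.single (Word as) 1) \<le> 1" for as
  proof (induction as)
    case Nil
    then show ?case using cstar_seminorm_one_le by (metis single_one zero_star_word_def)
  next
    case (Cons a as)
    have "Poly_Mapping.single (Word (a # as)) (1::complex) =
        Poly_Mapping.single (Word [a]) 1 * Poly_Mapping.single (Word as) 1"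
      by (simp add: mult_single plus_star_word_def)
    then show ?case
      using cstar_seminorm_mult[of "Poly_Mapping.single (Word [a]) 1" "Poly_Mapping.single (Word as) 1"]
        mult_mono[OF assms[of a] Cons] cstar_seminorm_nonneg by (smt (verit))
  qed
  then show ?thesis by (metis letters.cases)
qed

lemma cstar_seminorm_le_coeffs:
  assumes "\<And>a. p (Poly_Mapping.single (Word [a]) 1) \<le> 1"
  shows "p x \<le> (\<Sum>w\<in>Poly_Mapping.keys x. cmod (Poly_Mapping.lookup x w))"
proof -
  have "x = (\<Sum>w\<in>Poly_Mapping.keys x. Poly_Mapping.single w (Poly_Mapping.lookup x w))"
    by (rule poly_mapping_eqI)
      (auto simp: lookup_sum lookup_single when_def in_keys_iff)
  also have "\<dots> = (\<Sum>w\<in>Poly_Mapping.keys x.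
      free_scale (Poly_Mapping.lookup x w) (Poly_Mapping.single w 1))"
    by (simp add: free_scale_def mult_single)
  finally have "p x \<le> (\<Sum>w\<in>Poly_Mapping.keys x.
      p (free_scale (Poly_Mapping.lookup x w) (Poly_Mapping.single w 1)))"
    using cstar_seminorm_sum by metis
  also have "\<dots> \<le> (\<Sum>w\<in>Poly_Mapping.keys x. cmod (Poly_Mapping.lookup x w))"
    using cstar_seminorm_word_le[OF assms]
    by (intro sum_mono) (simp add: cstar_seminorm_scale mult_left_le)
  finally show ?thesis .
qed

end

lemma power2_le_imp_le_one: "x \<le> 1" if "x\<^sup>2 \<le> x" for x :: real
proof (rule ccontr)
  assume "\<not> x \<le> 1"
  then have "x * 1 < x * x" by (intro mult_strict_left_mono) auto
  with that show False by (simp add: power2_eq_square)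
qed

lemma bounded_magic_relations: "bounded_relations (magic_relations :: ('v::finite \<times> 'v) free_star_algebra set)"
proof -
  have le: "p x \<le> (\<Sum>w\<in>Poly_Mapping.keys x. cmod (Poly_Mapping.lookup x w))"
    if "p \<in> relation_seminorms (magic_relations :: ('v \<times> 'v) free_star_algebra set)" for p x
  proof -
    have p: "cstar_seminorm p" and r: "\<And>r. r \<in> magic_relations \<Longrightarrow> p r = 0"
      using that by (auto simp: relation_seminorms_def)
    have bound: "p (free_gen (i, j)) \<le> 1 \<and> p (free_star (free_gen (i, j))) \<le> 1" for i j :: 'v
    proof -
      let ?u = "free_gen (i, j) :: ('v \<times> 'v) free_star_algebra"
      have r1: "p (free_star ?u - ?u) = 0" and r2: "p (?u * ?u - ?u) = 0"
        by (rule r; auto simp: magic_relations_def Let_def)+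
      have "p ((free_star ?u - ?u) * ?u) \<le> 0"
        using cstar_seminorm_mult[OF p, of "free_star ?u - ?u" ?u] r1 by simp
      moreover have "free_star ?u * ?u = (free_star ?u - ?u) * ?u + ((?u * ?u - ?u) + ?u)"
        by (simp add: algebra_simps)
      ultimately have "p (free_star ?u * ?u) \<le> p ?u"
        using cstar_seminorm_triangle[OF p, of "(free_star ?u - ?u) * ?u" "(?u * ?u - ?u) + ?u"]
          cstar_seminorm_triangle[OF p, of "?u * ?u - ?u" ?u] r2 by simp
      then have "(p ?u)\<^sup>2 \<le> p ?u" by (simp add: cstar_seminorm_star[OF p])
      then have "p ?u \<le> 1"
        by (rule power2_le_imp_le_one)
      moreover have "p (free_star ?u) \<le> p ?u"
        using cstar_seminorm_triangle[OF p, of "free_star ?u - ?u" ?u] r1 by simp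
      ultimately show ?thesis by simp
    qed
    have "p (Poly_Mapping.single (Word [a]) 1) \<le> 1" for a :: "('v \<times> 'v) letter"
    proof (cases a)
      case (Gen g) then show ?thesis using bound by (cases g) (simp add: free_gen_def)
    next
      case (Adj g) then show ?thesis using bound by (cases g) (simp add: free_star_gen)
    qed
    then show ?thesis by (rule cstar_seminorm_le_coeffs[OF p])
  qed
  show ?thesis unfolding bounded_relations_def bdd_above_def by (auto intro: le)
qed

lemma zero_in_relation_seminorms: "(\<lambda>_. 0) \<in> relation_seminorms R"
  by (simp add: relation_seminorms_def cstar_seminorm_def)

lemma universal_seminorm_upper:
  "bounded_relations R \<Longrightarrow> p \<in> relation_seminorms R \<Longrightarrow> p x \<le> universal_seminorm R x"
  unfolding universal_seminorm_def bounded_relations_def by (intro cSUP_upper) auto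

lemma universal_seminorm_least:
  "(\<And>p. p \<in> relation_seminorms R \<Longrightarrow> p x \<le> c) \<Longrightarrow> universal_seminorm R x \<le> c"
  unfolding universal_seminorm_def using zero_in_relation_seminorms by (intro cSUP_least) auto

theorem universal_seminorm_greatest:
  assumes "bounded_relations R"
  shows "universal_seminorm R \<in> relation_seminorms R"
    and "p \<in> relation_seminorms R \<Longrightarrow> p x \<le> universal_seminorm R x"
proof -
  let ?q = "universal_seminorm R"
  note up = universal_seminorm_upper[OF assms]
  have cs: "cstar_seminorm p" if "p \<in> relation_seminorms R" for p
    using that by (simp add: relation_seminorms_def)
  have nonneg: "0 \<le> ?q x" for x using up[OF zero_in_relation_seminorms] .
  have "?q (x + y) \<le> ?q x + ?q y" for x y
    by (rule universal_seminorm_least)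
      (use cstar_seminorm_triangle[OF cs] up in \<open>meson add_mono order_trans\<close>)
  moreover have "?q (x * y) \<le> ?q x * ?q y" for x y
    by (rule universal_seminorm_least)
      (use cstar_seminorm_mult[OF cs] cstar_seminorm_nonneg[OF cs] nonneg up in
        \<open>meson mult_mono order_trans\<close>)
  moreover have "?q (free_scale c x) = cmod c * ?q x" for c x
  proof (rule antisym)
    show "?q (free_scale c x) \<le> cmod c * ?q x"
      by (rule universal_seminorm_least) (simp add: cstar_seminorm_scale[OF cs] mult_left_mono up)
    show "cmod c * ?q x \<le> ?q (free_scale c x)"
    proof (cases "c = 0")
      case False
      have "?q x \<le> ?q (free_scale c x) / cmod c"
      proof (rule universal_seminorm_least)
        fix p assume "p \<in> relation_seminorms R"
        then show "p x \<le> ?q (free_scale c x) / cmod c"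
          using up[of p "free_scale c x"] cstar_seminorm_scale[OF cs, of p c x] False
          by (simp add: field_simps)
      qed
      with False show ?thesis by (simp add: field_simps)
    qed (simp add: nonneg)
  qed
  moreover have "?q (free_star x * x) = (?q x)\<^sup>2" for x
  proof (rule antisym)
    show "?q (free_star x * x) \<le> (?q x)\<^sup>2"
      by (rule universal_seminorm_least)
        (simp add: cstar_seminorm_star[OF cs] power_mono cstar_seminorm_nonneg[OF cs] up)
    have "?q x \<le> sqrt (?q (free_star x * x))"
    proof (rule universal_seminorm_least)
      fix p assume "p \<in> relation_seminorms R"
      then show "p x \<le> sqrt (?q (free_star x * x))"
        using up[of p "free_star x * x"] cstar_seminorm_star[OF cs, of p x]
        by (simp add: real_le_rsqrt)
    qed
    then show "(?q x)\<^sup>2 \<le> ?q (free_star x * x)"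
      using power_mono[OF _ nonneg, of x _ 2] nonneg by fastforce
  qed
  ultimately have "cstar_seminorm ?q" by (simp add: cstar_seminorm_def)
  moreover have "?q r = 0" if "r \<in> R" for r
    using that by (intro antisym nonneg universal_seminorm_least) (auto simp: relation_seminorms_def)
  ultimately show "?q \<in> relation_seminorms R" by (simp add: relation_seminorms_def)
  show "p \<in> relation_seminorms R \<Longrightarrow> p x \<le> universal_seminorm R x" by (rule up)
qed

context
  fixes p :: "'g free_star_algebra \<Rightarrow> real"
  assumes p: "cstar_seminorm p"
begin

lemma cauchy_for_convergent:
  assumes "cauchy_for p s"
  shows "(\<lambda>n. p (s n)) \<longlonglongrightarrow> lim (\<lambda>n. p (s n))"
proof -
  have "Cauchy (\<lambda>n. p (s n))"
    using assms cstar_seminorm_reverse[OF p]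
    unfolding cauchy_for_def Cauchy_def dist_real_def by (meson order_le_less_trans)
  then show ?thesis by (simp add: Cauchy_convergent_iff convergent_LIMSEQ_iff)
qed

lemma cauchy_for_const: "cauchy_for p (\<lambda>n. x)"
  by (simp add: cauchy_for_def cstar_seminorm_zero[OF p])

lemma cauchy_for_add:
  assumes "cauchy_for p s" "cauchy_for p t"
  shows "cauchy_for p (\<lambda>n. s n + t n)"
  unfolding cauchy_for_def
proof (intro allI impI)
  fix e :: real assume "e > 0"
  then obtain M N where M: "\<forall>m\<ge>M. \<forall>n\<ge>M. p (s m - s n) < e/2" and N: "\<forall>m\<ge>N. \<forall>n\<ge>N. p (t m - t n) < e/2"
    using assms unfolding cauchy_for_def by (metis half_gt_zero)
  show "\<exists>N. \<forall>m\<ge>N. \<forall>n\<ge>N. p (s m + t m - (s n + t n)) < e"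
  proof (intro exI allI impI)
    fix m n assume "max M N \<le> m" "max M N \<le> n"
    then have "p (s m - s n) < e/2" "p (t m - t n) < e/2" using M N by auto
    then show "p (s m + t m - (s n + t n)) < e"
      using cstar_seminorm_triangle[OF p, of "s m - s n" "t m - t n"] by (simp add: algebra_simps)
  qed
qed

lemma cauchy_for_mult:
  assumes s: "cauchy_for p s" and t: "cauchy_for p t"
  shows "cauchy_for p (\<lambda>n. s n * t n)"
  unfolding cauchy_for_def
proof (intro allI impI)
  fix e :: real assume e: "e > 0"
  have "Bseq (\<lambda>n. p (s n))" "Bseq (\<lambda>n. p (t n))"
    using cauchy_for_convergent s t convergentI convergent_imp_Bseq by blast+
  then obtain K L where K: "K > 0" "\<And>n. p (s n) \<le> K" and L: "L > 0" "\<And>n. p (t n) \<le> L"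
    unfolding Bseq_def by (metis abs_le_D1 real_norm_def)
  obtain M N where M: "\<forall>m\<ge>M. \<forall>n\<ge>M. p (s m - s n) < e/(2*L)"
    and N: "\<forall>m\<ge>N. \<forall>n\<ge>N. p (t m - t n) < e/(2*K)"
    using s t e K(1) L(1) unfolding cauchy_for_def
    by (metis divide_pos_pos mult_pos_pos zero_less_numeral)
  show "\<exists>N. \<forall>m\<ge>N. \<forall>n\<ge>N. p (s m * t m - s n * t n) < e"
  proof (intro exI allI impI)
    fix m n assume mn: "max M N \<le> m" "max M N \<le> n"
    have a: "p (s m - s n) < e/(2*L)" and b: "p (t m - t n) < e/(2*K)" using M N mn by auto
    have "p (s m * t m - s n * t n) = p ((s m - s n) * t m + s n * (t m - t n))"
      by (simp add: algebra_simps)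
    also have "\<dots> \<le> p ((s m - s n) * t m) + p (s n * (t m - t n))"
      by (rule cstar_seminorm_triangle[OF p])
    also have "\<dots> \<le> p (s m - s n) * p (t m) + p (s n) * p (t m - t n)"
      by (intro add_mono cstar_seminorm_mult[OF p])
    also have "\<dots> \<le> p (s m - s n) * L + K * p (t m - t n)"
      by (intro add_mono mult_left_mono mult_right_mono K L cstar_seminorm_nonneg[OF p])
    also have "\<dots> < e/(2*L) * L + K * (e/(2*K))"
      using a b K(1) L(1) by (intro add_strict_mono mult_strict_right_mono mult_strict_left_mono)
    also have "\<dots> = e" using K(1) L(1) by simp
    finally show "p (s m * t m - s n * t n) < e" .
  qed
qed

lemma cauchy_for_uminus: "cauchy_for p s \<Longrightarrow> cauchy_for p (\<lambda>n. - s n)"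
  using cauchy_for_mult[OF cauchy_for_const[of "-1"]] by simp

lemma ring_cauchy_algebra: "ring (cauchy_algebra p)"
proof (rule ringI)
  show "abelian_group (cauchy_algebra p)"
  proof (rule abelian_groupI)
    fix s assume "s \<in> carrier (cauchy_algebra p)"
    then show "\<exists>t\<in>carrier (cauchy_algebra p).
        t \<oplus>\<^bsub>cauchy_algebra p\<^esub> s = \<zero>\<^bsub>cauchy_algebra p\<^esub>"
      by (intro bexI[of _ "\<lambda>n. - s n"]) (auto simp: cauchy_algebra_def cauchy_for_uminus)
  qed (auto simp: cauchy_algebra_def cauchy_for_const cauchy_for_add algebra_simps)
  show "Group.monoid (cauchy_algebra p)"
    by (rule monoidI) (auto simp: cauchy_algebra_def cauchy_for_const cauchy_for_mult algebra_simps)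
qed (auto simp: cauchy_algebra_def algebra_simps)

lemma null_ideal_iff:
  "s \<in> null_ideal (cauchy_algebra p) \<longleftrightarrow> cauchy_for p s \<and> (\<lambda>n. p (s n)) \<longlonglongrightarrow> 0"
proof -
  have "s \<in> null_ideal (cauchy_algebra p) \<longleftrightarrow> cauchy_for p s \<and> lim (\<lambda>n. p (s n)) = 0"
    by (simp add: null_ideal_def cauchy_algebra_def)
  moreover have "lim (\<lambda>n. p (s n)) = 0 \<longleftrightarrow> (\<lambda>n. p (s n)) \<longlonglongrightarrow> 0" if "cauchy_for p s"
    using cauchy_for_convergent[OF that] limI by metis
  ultimately show ?thesis by blast
qed

lemma ideal_null_ideal: "ideal (null_ideal (cauchy_algebra p)) (cauchy_algebra p)"
proof (rule idealI[OF ring_cauchy_algebra])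
  interpret ring "cauchy_algebra p" by (rule ring_cauchy_algebra)
  have bound: "\<exists>K. \<forall>n. p (s n) \<le> K" if "cauchy_for p s" for s
    using convergent_imp_Bseq[OF convergentI, OF cauchy_for_convergent[OF that]]
    unfolding Bseq_def by (metis abs_le_D1 real_norm_def)
  have sq: "(\<lambda>n. p (f n)) \<longlonglongrightarrow> 0" if "g \<longlonglongrightarrow> 0" "\<And>n. p (f n) \<le> g n" for f g
    using cstar_seminorm_nonneg[OF p] that by (intro tendsto_sandwich[OF _ _ tendsto_const that(1)]) auto
  show "subgroup (null_ideal (cauchy_algebra p)) (add_monoid (cauchy_algebra p))"
  proof (rule add.subgroupI)
    show "null_ideal (cauchy_algebra p) \<subseteq> carrier (cauchy_algebra p)" by (auto simp: null_ideal_def)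
    have "(\<lambda>n. 0) \<in> null_ideal (cauchy_algebra p)"
      by (simp add: null_ideal_iff cauchy_for_const cstar_seminorm_zero[OF p])
    then show "null_ideal (cauchy_algebra p) \<noteq> {}" by blast
  next
    fix s assume s: "s \<in> null_ideal (cauchy_algebra p)"
    have "\<ominus>\<^bsub>cauchy_algebra p\<^esub> s = (\<lambda>n. - s n)"
      using s unfolding null_ideal_iff
      by (intro minus_equality) (auto simp: cauchy_algebra_def cauchy_for_uminus)
    with s show "\<ominus>\<^bsub>cauchy_algebra p\<^esub> s \<in> null_ideal (cauchy_algebra p)"
      by (simp add: null_ideal_iff cauchy_for_uminus cstar_seminorm_uminus[OF p])
  next
    fix s t assume st: "s \<in> null_ideal (cauchy_algebra p)" "t \<in> null_ideal (cauchy_algebra p)"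
    then have "(\<lambda>n. p (s n) + p (t n)) \<longlonglongrightarrow> 0" by (auto simp: null_ideal_iff intro: tendsto_add_zero)
    from sq[OF this cstar_seminorm_triangle[OF p]] st
    show "s \<oplus>\<^bsub>cauchy_algebra p\<^esub> t \<in> null_ideal (cauchy_algebra p)"
      by (auto simp: null_ideal_iff cauchy_for_add) (auto simp: cauchy_algebra_def cauchy_for_add)
  qed
  fix s t
  assume s: "s \<in> null_ideal (cauchy_algebra p)" and t: "t \<in> carrier (cauchy_algebra p)"
  have t': "cauchy_for p t" using t by (simp add: cauchy_algebra_def)
  obtain K where K: "\<And>n. p (t n) \<le> K" using bound[OF t'] by blast
  have lim: "(\<lambda>n. p (s n) * K) \<longlonglongrightarrow> 0" "(\<lambda>n. K * p (s n)) \<longlonglongrightarrow> 0"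
    using s by (auto simp: null_ideal_iff intro: tendsto_mult_left_zero tendsto_mult_right_zero)
  have "p (s n * t n) \<le> p (s n) * K" "p (t n * s n) \<le> K * p (s n)" for n
    using cstar_seminorm_mult[OF p] K cstar_seminorm_nonneg[OF p]
    by (meson mult_left_mono mult_right_mono order_trans)+
  with sq[OF lim(1)] sq[OF lim(2)] s t'
  show "t \<otimes>\<^bsub>cauchy_algebra p\<^esub> s \<in> null_ideal (cauchy_algebra p)"
    and "s \<otimes>\<^bsub>cauchy_algebra p\<^esub> t \<in> null_ideal (cauchy_algebra p)"
    by (simp_all add: null_ideal_iff cauchy_for_mult) (simp_all add: cauchy_algebra_def null_ideal_iff cauchy_for_mult)
qed

end

lemma ring_quotient_algebra:
  assumes "ideal I A"
  shows "ring (quotient_algebra A I)"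
proof -
  interpret Q: ring "A Quot I" by (rule ideal.quotient_is_ring[OF assms])
  show ?thesis
  proof (rule ringI)
    show "abelian_group (quotient_algebra A I)"
      by (rule abelian_groupI)
        (use Q.a_assoc Q.a_comm Q.add.inv_closed Q.l_neg in \<open>auto simp: quotient_algebra_def\<close>)
    show "Group.monoid (quotient_algebra A I)"
      by (rule monoidI) (auto simp: quotient_algebra_def Q.m_assoc)
  qed (auto simp: quotient_algebra_def Q.l_distr Q.r_distr)
qed

lemma cstar_seminorm_magic:
  "cstar_seminorm (universal_seminorm (magic_relations :: ('v::finite \<times> 'v) free_star_algebra set))"
  using universal_seminorm_greatest(1)[OF bounded_magic_relations[where 'v = 'v]]
  by (simp add: relation_seminorms_def)

theorem ring_A_s: "ring A_s"
  unfolding A_s_def universal_cstar_algebra_def Let_def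
  by (rule ring_quotient_algebra[OF ideal_null_ideal[OF cstar_seminorm_magic]])

lemma magic_gen_carrier: "magic_gen i j \<in> carrier A_s"
proof -
  have "(\<lambda>n. free_gen (i, j)) \<in> carrier (cauchy_algebra (universal_seminorm magic_relations))"
    by (simp add: cauchy_algebra_def cauchy_for_const[OF cstar_seminorm_magic])
  then show ?thesis
    by (auto simp: magic_gen_def universal_gen_def A_s_def universal_cstar_algebra_def Let_def
        quotient_algebra_def FactRing_def A_RCOSETS_def')
qed

lemma smult_A_s_carrier:
  fixes X :: "'v::finite magic_element"
  assumes "X \<in> carrier A_s"
  shows "c \<odot>\<^bsub>A_s\<^esub> X \<in> carrier A_s"
proof -
  define C where "C = cauchy_algebra (universal_seminorm (magic_relations :: ('v \<times> 'v) free_star_algebra set))"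
  define N where "N = null_ideal C"
  interpret N: ideal N C
    unfolding N_def C_def by (rule ideal_null_ideal[OF cstar_seminorm_magic])
  define k where "k = (\<lambda>n::nat. Poly_Mapping.single 0 c :: ('v \<times> 'v) free_star_algebra)"
  have k: "k \<in> carrier C"
    by (simp add: k_def C_def cauchy_algebra_def cauchy_for_const[OF cstar_seminorm_magic])
  have smult: "c \<odot>\<^bsub>C\<^esub> s = k \<otimes>\<^bsub>C\<^esub> s" for s
    by (simp add: C_def cauchy_algebra_def k_def free_scale_def)
  have A: "A_s = quotient_algebra C N"
    by (simp add: A_s_def universal_cstar_algebra_def C_def N_def Let_def)
  obtain s where s: "s \<in> carrier C" and X: "X = N +>\<^bsub>C\<^esub> s"
    using assms by (auto simp: A quotient_algebra_def FactRing_def A_RCOSETS_def')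
  have eq: "N +>\<^bsub>C\<^esub> (k \<otimes>\<^bsub>C\<^esub> x) = N +>\<^bsub>C\<^esub> (k \<otimes>\<^bsub>C\<^esub> s)" if "x \<in> X" for x
  proof -
    from that obtain h where h: "h \<in> N" and x: "x = h \<oplus>\<^bsub>C\<^esub> s"
      by (auto simp: X a_r_coset_def')
    have "k \<otimes>\<^bsub>C\<^esub> x = k \<otimes>\<^bsub>C\<^esub> h \<oplus>\<^bsub>C\<^esub> k \<otimes>\<^bsub>C\<^esub> s"
      using h s k by (simp add: x N.r_distr N.a_Hcarr)
    then have "k \<otimes>\<^bsub>C\<^esub> x \<in> N +>\<^bsub>C\<^esub> (k \<otimes>\<^bsub>C\<^esub> s)"
      using N.I_l_closed[OF h k] by (auto simp: a_r_coset_def')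
    then show ?thesis using k s by (intro N.a_repr_independence'[symmetric]) auto
  qed
  have "s \<in> X" using s by (simp add: X N.a_rcos_self)
  with eq have "(\<Union>x\<in>X. N +>\<^bsub>C\<^esub> (c \<odot>\<^bsub>C\<^esub> x)) = N +>\<^bsub>C\<^esub> (k \<otimes>\<^bsub>C\<^esub> s)"
    unfolding smult by blast
  then have "c \<odot>\<^bsub>A_s\<^esub> X = N +>\<^bsub>C\<^esub> (k \<otimes>\<^bsub>C\<^esub> s)"
    by (simp add: A quotient_algebra_def)
  then show ?thesis
    using k s by (auto simp: A quotient_algebra_def FactRing_def A_RCOSETS_def')
qed

theorem ring_quantum_automorphism_algebra: "ring (quantum_automorphism_algebra E)"
proof -
  let ?A = "A_s :: 'a magic_element normed_star_algebra"
  interpret ring ?A by (rule ring_A_s)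
  have "finsum ?A (\<lambda>k. c k \<odot>\<^bsub>A_s\<^esub> magic_gen (f k) (g k)) UNIV \<in> carrier ?A" for c f g
    by (rule finsum_closed) (auto intro: smult_A_s_carrier magic_gen_carrier)
  then have sub: "commutation_relations E \<subseteq> carrier ?A"
    unfolding commutation_relations_def Let_def by (auto intro!: minus_closed)
  have "closed_ideal ?A (carrier ?A)" by (simp add: closed_ideal_def oneideal)
  with sub have "ideal (generated_closed_ideal ?A (commutation_relations E)) ?A"
    unfolding generated_closed_ideal_def
    by (intro i_Intersect) (auto simp: closed_ideal_def)
  then show ?thesis
    unfolding quantum_automorphism_algebra_def by (rule ring_quotient_algebra)
qed

lemma C13_3_4_simple_graph: "C13_3_4 i j \<Longrightarrow> C13_3_4 j i" "\<not> C13_3_4 i i"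
proof -
  have neg: "j - i = - (i - j)" by (rule minus_diff_eq[symmetric])
  show "C13_3_4 i j \<Longrightarrow> C13_3_4 j i"
    unfolding C13_3_4_def neg
    by (elim insertE) (simp_all only: insert_iff minus_minus simp_thms empty_iff)
  show "\<not> C13_3_4 i i" by (simp add: C13_3_4_def)
qed

end

theory Submission
  imports Defs "HOL-Algebra.Multiplicative_Group"
begin

text \<open>
  Write \<open>u i j\<close> for the generators, seen in the quotient algebra. Since \<open>u\<close> commutes with the adjacency
  matrix, \<open>u i j * u k l = 0\<close> unless \<open>i, k\<close> are related (adjacent or not) in the same way as \<open>j, l\<close>.
  The heart of the proof is that the sandwiches \<open>M c = u x a * u i c * u x b\<close> vanish for all \<open>x\<close>, \<open>i\<close>, \<open>c\<close>
  and all \<open>a \<noteq> b\<close>. Once this is known, inserting \<open>1\<close> as the sum of row \<open>x\<close> on the right of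
  \<open>u x a * u i c\<close>, and on the left of \<open>u i c * u x a\<close>, turns both products into
  \<open>u x a * u i c * u x a\<close>, so they agree.

  Fix \<open>x\<close>, \<open>i\<close>, \<open>a \<noteq> b\<close>. Then \<open>M c\<close> can only be nonzero if \<open>c\<close> is different from \<open>a\<close> and \<open>b\<close> and is related to
  each of them as \<open>i\<close> is to \<open>x\<close>. Let \<open>j\<close> be a vertex adjacent to exactly one of \<open>a\<close> and \<open>b\<close>. Then
  \<open>u x a * u k j * u x b = 0\<close> for every \<open>k\<close>, because \<open>k\<close> would have to be related to \<open>x\<close> both as \<open>j\<close> is to
  \<open>a\<close> and as \<open>j\<close> is to \<open>b\<close>. Summing this over the neighbours \<open>k\<close> of \<open>i\<close> and using that \<open>u\<close> commutes with
  the adjacency matrix, one finds that the sum of \<open>M c\<close> over the neighbours \<open>c\<close> of \<open>j\<close> is zero; as the sum of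
  \<open>M c\<close> over all \<open>c\<close> is \<open>u x a * u x b = 0\<close>, the same is true for the sum over the non-neighbours of \<open>j\<close>. If
  for each candidate \<open>c\<close> some such \<open>j\<close> distinguishes \<open>c\<close> from all other candidates by its adjacency to \<open>j\<close>, one
  of these two sums consists of the single term \<open>M c\<close>, and \<open>M c = 0\<close>. This combinatorial condition
  (\<open>separates_types\<close>) holds for the given graph, which is the Paley graph on 13 vertices: two vertices
  have at most three common neighbours and at most three common non-neighbours, and a finite check finds
  the vertices \<open>j\<close>.

  It remains to pass from the generators to the whole algebra. Every element is the class of a Cauchy
  sequence of *-polynomials in the generators. The *-polynomials have commuting classes because the
  generators do (an adjoint of a generator has the same class as the generator). So for two elements,
  the commutator of the representing sequences is a Cauchy sequence of *-polynomials lying in the ideal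
  that is divided out, and since this ideal is closed, the limit lies in it as well.
\<close>

section \<open>Magic unitaries commuting with an adjacency matrix\<close>

text \<open>The vertices \<open>c'\<close> of the inner quantifier are those that have the same relation to \<open>a\<close> and \<open>b\<close> as \<open>c\<close>.
  The vertex \<open>j\<close> tells \<open>a\<close> from \<open>b\<close> and isolates \<open>c\<close> within this class.\<close>

definition separates_types :: "('v \<Rightarrow> 'v \<Rightarrow> bool) \<Rightarrow> bool" where
  "separates_types E \<longleftrightarrow>
     (\<forall>a b c. a \<noteq> b \<and> c \<noteq> a \<and> c \<noteq> b \<and> E c a = E c b \<longrightarrow>
       (\<exists>j. E j a \<noteq> E j b \<and>
         (\<forall>c'. c' \<noteq> c \<and> c' \<noteq> a \<and> c' \<noteq> b \<and> E c' a = E c a \<and> E c' b = E c a \<longrightarrow> E c' j \<noteq> E c j)))"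

lemma (in ring) finsum_only:
  assumes "finite A" "f \<in> A \<rightarrow> carrier R" "\<And>k. k \<in> A \<Longrightarrow> k \<noteq> c \<Longrightarrow> f k = \<zero>"
  shows "finsum R f A = (if c \<in> A then f c else \<zero>)"
proof (cases "c \<in> A")
  case True
  have "finsum R f A = finsum R (\<lambda>k. if c = k then f k else \<zero>) A"
    using assms by (intro add.finprod_cong') (auto simp: Pi_iff)
  with True assms show ?thesis by (simp add: add.finprod_singleton)
next
  case False
  then have "finsum R f A = finsum R (\<lambda>k. \<zero>) A"
    using assms by (intro add.finprod_cong') auto
  with False show ?thesis by simp
qed

text \<open>The entries live in an arbitrary ring: the argument is purely algebraic.\<close>

locale graph_magic_unitary = ring R for R (structure) +
  fixes u :: "'v::finite \<Rightarrow> 'v \<Rightarrow> 'a" and E :: "'v \<Rightarrow> 'v \<Rightarrow> bool"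
  assumes u_closed [simp, intro]: "u i j \<in> carrier R"
    and idem: "u i j \<otimes> u i j = u i j"
    and row_orth: "j \<noteq> k \<Longrightarrow> u i j \<otimes> u i k = \<zero>"
    and col_orth: "i \<noteq> j \<Longrightarrow> u i k \<otimes> u j k = \<zero>"
    and row_sum: "(\<Oplus>k\<in>UNIV. u i k) = \<one>"
    and intertwines: "(\<Oplus>k\<in>{k. E i k}. u k j) = (\<Oplus>k\<in>{k. E k j}. u i k)"
begin

lemma two_sided_sum:
  assumes "finite A" "x \<in> carrier R" "y \<in> carrier R" "f \<in> A \<rightarrow> carrier R"
  shows "x \<otimes> finsum R f A \<otimes> y = (\<Oplus>k\<in>A. x \<otimes> f k \<otimes> y)"
  using assms by (simp add: finsum_rdistr finsum_ldistr Pi_iff)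

lemma sandwiched_intertwines:
  assumes "x \<in> carrier R" "y \<in> carrier R"
  shows "(\<Oplus>k\<in>{k. E i k}. x \<otimes> u k j \<otimes> y) = (\<Oplus>k\<in>{k. E k j}. x \<otimes> u i k \<otimes> y)"
  using two_sided_sum[of "{k. E i k}" x y "\<lambda>k. u k j"] two_sided_sum[of "{k. E k j}" x y "u i"]
    intertwines[where i = i and j = j] assms by simp

text \<open>Sandwiching the intertwining relation at \<open>(i, l)\<close> between \<open>u i j\<close> and \<open>u k l\<close> leaves the product
  \<open>u i j \<otimes> u k l\<close> on the left if \<open>E i k\<close> and on the right if \<open>E j l\<close>, and zero otherwise.\<close>

lemma orthogonal_if_type_differs:
  assumes "E i k \<noteq> E j l"
  shows "u i j \<otimes> u k l = \<zero>"
proof -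
  have "(\<Oplus>k'\<in>{k'. E i k'}. u i j \<otimes> u k' l \<otimes> u k l) = (if E i k then u i j \<otimes> u k l else \<zero>)"
    by (subst finsum_only[where c = k]) (auto simp: m_assoc idem col_orth)
  moreover have "(\<Oplus>l'\<in>{l'. E l' l}. u i j \<otimes> u i l' \<otimes> u k l) = (if E j l then u i j \<otimes> u k l else \<zero>)"
    by (subst finsum_only[where c = j]) (auto simp: idem row_orth)
  ultimately show ?thesis
    using assms sandwiched_intertwines[of "u i j" "u k l", where i = i and j = l] by (auto split: if_splits)
qed

lemma sandwich_zero_if_type_differs:
  assumes "E x i \<noteq> E a c \<or> E i x \<noteq> E c b"
  shows "u x a \<otimes> u i c \<otimes> u x b = \<zero>"
  using assms
proof
  assume "E i x \<noteq> E c b"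
  then show ?thesis by (simp add: m_assoc orthogonal_if_type_differs)
qed (simp add: orthogonal_if_type_differs)

lemma sandwich_zero_at_endpoints:
  assumes "a \<noteq> b" "c = a \<or> c = b"
  shows "u x a \<otimes> u i c \<otimes> u x b = \<zero>"
proof (cases "i = x")
  case True
  with assms show ?thesis by (auto simp: m_assoc idem row_orth)
next
  case False
  with assms have "u x a \<otimes> u i c = \<zero> \<or> u i c \<otimes> u x b = \<zero>" by (auto simp: col_orth)
  then show ?thesis
  proof
    assume "u i c \<otimes> u x b = \<zero>"
    then show ?thesis by (simp add: m_assoc)
  qed simp
qed

text \<open>A vertex \<open>j\<close> that tells \<open>a\<close> from \<open>b\<close> makes the sandwiches sum to zero over the neighbours of \<open>j\<close> and
  over its non-neighbours. The separation condition supplies a \<open>j\<close> for which one of these sums has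
  the given sandwich as its only term.\<close>

lemma sandwich_zero:
  assumes sym: "\<And>i j. E i j = E j i" and sep: "separates_types E" and "a \<noteq> b"
  shows "u x a \<otimes> u i c \<otimes> u x b = \<zero>"
proof -
  let ?M = "\<lambda>c. u x a \<otimes> u i c \<otimes> u x b"
  show ?thesis
  proof (cases "c \<noteq> a \<and> c \<noteq> b \<and> E c a = E c b \<and> E x i = E c a")
    case False
    with sym[of a c] sym[of x i] show ?thesis
      using sandwich_zero_if_type_differs[of x i a c b] sandwich_zero_at_endpoints[OF \<open>a \<noteq> b\<close>] by metis
  next
    case True
    then obtain j where j: "E j a \<noteq> E j b"
      and only: "\<And>c'. c' \<noteq> c \<Longrightarrow> c' \<noteq> a \<Longrightarrow> c' \<noteq> b \<Longrightarrow> E c' a = E c a \<Longrightarrow> E c' b = E c a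
        \<Longrightarrow> E c' j \<noteq> E c j"
      using sep \<open>a \<noteq> b\<close> unfolding separates_types_def by metis
    have zero: "?M c' = \<zero>" if "c' \<noteq> c" "E c' j = E c j" for c'
      using only[of c'] that True sym[of a c'] sym[of x i] sandwich_zero_if_type_differs[of x i a c' b]
        sandwich_zero_at_endpoints[OF \<open>a \<noteq> b\<close>] by metis
    \<comment> \<open>A nonzero term would force \<open>E k x = E a j\<close> and \<open>E k x = E j b\<close>.\<close>
    have "(\<Oplus>k\<in>{k. E i k}. u x a \<otimes> u k j \<otimes> u x b) = (\<Oplus>k\<in>{k. E i k}. \<zero>)"
      using j sym by (intro add.finprod_cong') (auto intro!: sandwich_zero_if_type_differs)
    then have nbrs: "(\<Oplus>c'\<in>{c'. E c' j}. ?M c') = \<zero>"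
      by (simp add: sandwiched_intertwines)
    have "(\<Oplus>c'\<in>UNIV. ?M c') = u x a \<otimes> \<one> \<otimes> u x b"
      using two_sided_sum[of UNIV "u x a" "u x b" "u i"] by (simp add: row_sum)
    then have all: "(\<Oplus>c'\<in>UNIV. ?M c') = \<zero>"
      using \<open>a \<noteq> b\<close> by (simp add: row_orth)
    have "(\<Oplus>c'\<in>UNIV. ?M c') = (\<Oplus>c'\<in>{c'. E c' j}. ?M c') \<oplus> (\<Oplus>c'\<in>{c'. \<not> E c' j}. ?M c')"
      by (subst finsum_Un_disjoint[symmetric]) (auto intro: arg_cong2[where f = "finsum R"])
    with nbrs all have non_nbrs: "(\<Oplus>c'\<in>{c'. \<not> E c' j}. ?M c') = \<zero>"
      by simp
    have "(\<Oplus>c'\<in>{c'. E c' j = E c j}. ?M c') = ?M c"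
      by (subst finsum_only[where c = c]) (auto simp: zero)
    with nbrs non_nbrs show ?thesis by (cases "E c j") auto
  qed
qed

text \<open>Both products are equal to the palindrome \<open>u x a \<otimes> u i c \<otimes> u x a\<close>: the row sum of \<open>x\<close>, multiplied on
  the outer side, contributes no other term.\<close>

lemma entries_commute:
  assumes "\<And>i j. E i j = E j i" and "separates_types E"
  shows "u x a \<otimes> u i c = u i c \<otimes> u x a"
proof -
  note zero = sandwich_zero[OF assms]
  have "u x a \<otimes> u i c = u x a \<otimes> u i c \<otimes> (\<Oplus>b\<in>UNIV. u x b)"
    by (simp add: row_sum)
  also have "\<dots> = (\<Oplus>b\<in>UNIV. u x a \<otimes> u i c \<otimes> u x b)"
    by (simp add: finsum_rdistr)
  also have "\<dots> = u x a \<otimes> u i c \<otimes> u x a"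
    by (subst finsum_only[where c = a]) (auto simp: zero)
  also have "\<dots> = (\<Oplus>b\<in>UNIV. u x b \<otimes> u i c \<otimes> u x a)"
    by (subst finsum_only[where c = a]) (auto simp: zero)
  also have "\<dots> = (\<Oplus>b\<in>UNIV. u x b \<otimes> (u i c \<otimes> u x a))"
    by (simp add: m_assoc)
  also have "\<dots> = (\<Oplus>b\<in>UNIV. u x b) \<otimes> (u i c \<otimes> u x a)"
    by (simp add: finsum_ldistr)
  also have "\<dots> = u i c \<otimes> u x a"
    by (simp add: row_sum)
  finally show ?thesis .
qed

end

section \<open>The graph on 13 vertices\<close>

text \<open>The connection set consists of the nonzero squares modulo 13.\<close>

definition residue_13 :: "int \<Rightarrow> bool" where
  "residue_13 d \<longleftrightarrow> d mod 13 \<in> {1, 3, 4, 9, 10, 12}"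

lemma of_int_13_eq_iff: "(of_int x :: 13) = of_int y \<longleftrightarrow> x mod 13 = y mod 13"
proof -
  have "(of_int x :: 13) = of_int y \<longleftrightarrow> (of_int (x - y) :: 13) = 0" by simp
  also have "\<dots> \<longleftrightarrow> 13 dvd x - y"
    by (subst of_int_eq_0_iff_char_dvd) auto
  finally show ?thesis by (simp add: mod_eq_dvd_iff)
qed

lemma C13_3_4_of_int: "C13_3_4 (of_int x) (of_int y) = residue_13 (x - y)"
proof -
  have "C13_3_4 (of_int x) (of_int y) \<longleftrightarrow> (\<exists>s\<in>{1, -1, 3, -3, 4, -4}. (of_int (x - y) :: 13) = of_int s)"
    by (simp add: C13_3_4_def)
  also have "\<dots> \<longleftrightarrow> (\<exists>s\<in>{1, -1, 3, -3, 4, -4}. (x - y) mod 13 = s mod 13)"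
    by (simp only: of_int_13_eq_iff)
  also have "\<dots> \<longleftrightarrow> residue_13 (x - y)"
    unfolding residue_13_def by auto
  finally show ?thesis .
qed

lemma ex_of_int_13: "\<exists>z\<in>set [0..12]. (x :: 13) = of_int z"
  by (cases x) (auto simp: set_upto)

text \<open>Translations are automorphisms, so it suffices to separate the pairs \<open>0\<close>, \<open>b\<close>. For \<open>b = 1\<close>, say,
  the common neighbours \<open>4\<close> and \<open>10\<close> are isolated by their neighbours \<open>5\<close> and \<open>11\<close>; the common
  non-neighbours \<open>6\<close>, \<open>7\<close>, \<open>8\<close> are isolated by \<open>2\<close>, adjacent to \<open>6\<close> only, by \<open>9\<close>, adjacent to all but
  \<open>7\<close>, and by \<open>12\<close>, adjacent to \<open>8\<close> only.\<close>

lemma residue_13_separates: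
  "\<forall>b\<in>set [0..12]. \<forall>c\<in>set [0..12]. b \<noteq> 0 \<and> c \<noteq> 0 \<and> c \<noteq> b \<and> residue_13 c = residue_13 (c - b) \<longrightarrow>
     (\<exists>j\<in>set [0..12]. residue_13 j \<noteq> residue_13 (j - b) \<and>
       (\<forall>c'\<in>set [0..12]. c' \<noteq> c \<and> c' \<noteq> 0 \<and> c' \<noteq> b \<and> residue_13 c' = residue_13 c \<and>
         residue_13 (c' - b) = residue_13 c \<longrightarrow> residue_13 (c' - j) \<noteq> residue_13 (c - j)))"
  by code_simp

lemma C13_3_4_translate: "C13_3_4 (i - t) (j - t) = C13_3_4 i j"
  by (simp add: C13_3_4_def)

lemma separates_types_C13_3_4: "separates_types C13_3_4"
  unfolding separates_types_def
proof (intro allI impI)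
  fix a b c :: 13
  let ?E = C13_3_4
  assume *: "a \<noteq> b \<and> c \<noteq> a \<and> c \<noteq> b \<and> ?E c a = ?E c b"
  obtain \<beta> \<gamma> where \<beta>: "\<beta> \<in> set [0..12]" "b - a = of_int \<beta>" and \<gamma>: "\<gamma> \<in> set [0..12]" "c - a = of_int \<gamma>"
    using ex_of_int_13 by meson
  have E: "?E x y = residue_13 (\<xi> - \<eta>)" if "x - a = of_int \<xi>" "y - a = of_int \<eta>" for x y \<xi> \<eta>
    using C13_3_4_translate[of x a y] that by (simp add: C13_3_4_of_int)
  have a0: "a - a = of_int 0" by simp
  have coords: "b = of_int \<beta> + a" "c = of_int \<gamma> + a"
    using \<beta>(2) \<gamma>(2) by (simp_all add: diff_eq_eq)
  with * have "\<beta> \<noteq> 0 \<and> \<gamma> \<noteq> 0 \<and> \<gamma> \<noteq> \<beta>" by auto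
  moreover have "residue_13 \<gamma> = residue_13 (\<gamma> - \<beta>)"
    using * E[OF \<gamma>(2) a0] E[OF \<gamma>(2) \<beta>(2)] by simp
  ultimately obtain \<theta> where j: "residue_13 \<theta> \<noteq> residue_13 (\<theta> - \<beta>)"
    and only: "\<And>\<delta>. \<delta> \<in> set [0..12] \<Longrightarrow> \<delta> \<noteq> \<gamma> \<and> \<delta> \<noteq> 0 \<and> \<delta> \<noteq> \<beta> \<and> residue_13 \<delta> = residue_13 \<gamma> \<and>
      residue_13 (\<delta> - \<beta>) = residue_13 \<gamma> \<Longrightarrow> residue_13 (\<delta> - \<theta>) \<noteq> residue_13 (\<gamma> - \<theta>)"
    using residue_13_separates[THEN bspec, THEN bspec, OF \<beta>(1) \<gamma>(1)] by blast
  define j where "j = of_int \<theta> + a"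
  have \<theta>: "j - a = of_int \<theta>" by (simp add: j_def)
  show "\<exists>j. ?E j a \<noteq> ?E j b \<and> (\<forall>c'. c' \<noteq> c \<and> c' \<noteq> a \<and> c' \<noteq> b \<and> ?E c' a = ?E c a \<and>
      ?E c' b = ?E c a \<longrightarrow> ?E c' j \<noteq> ?E c j)"
  proof (intro exI conjI allI impI)
    show "?E j a \<noteq> ?E j b"
      using j E[OF \<theta> a0] E[OF \<theta> \<beta>(2)] by simp
    fix c' assume **: "c' \<noteq> c \<and> c' \<noteq> a \<and> c' \<noteq> b \<and> ?E c' a = ?E c a \<and> ?E c' b = ?E c a"
    obtain \<delta> where \<delta>: "\<delta> \<in> set [0..12]" "c' - a = of_int \<delta>"
      using ex_of_int_13 by meson
    have "c' = of_int \<delta> + a"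
      using \<delta>(2) by (simp add: diff_eq_eq)
    with ** coords have "\<delta> \<noteq> \<gamma> \<and> \<delta> \<noteq> 0 \<and> \<delta> \<noteq> \<beta>" by auto
    moreover have "residue_13 \<delta> = residue_13 \<gamma> \<and> residue_13 (\<delta> - \<beta>) = residue_13 \<gamma>"
      using ** unfolding E[OF \<delta>(2) a0] E[OF \<delta>(2) \<beta>(2)] E[OF \<gamma>(2) a0] diff_0_right by blast
    ultimately have "residue_13 (\<delta> - \<theta>) \<noteq> residue_13 (\<gamma> - \<theta>)"
      using only[OF \<delta>(1)] by blast
    then show "?E c' j \<noteq> ?E c j"
      unfolding E[OF \<delta>(2) \<theta>] E[OF \<gamma>(2) \<theta>] .
  qed
qed

section \<open>Quotients and closed ideals\<close>

lemma (in ring_hom_ring) hom_of_finsum: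
  assumes "finite B" "f \<in> B \<rightarrow> carrier R"
  shows "h (\<Oplus>i\<in>B. f i) = (\<Oplus>\<^bsub>S\<^esub>i\<in>B. h (f i))"
  using assms by (induction B rule: finite_induct) (auto simp: Pi_def)

lemma quotient_algebra_hom:
  assumes "ideal I A"
  shows "ring_hom_ring A (quotient_algebra A I) (\<lambda>x. I +>\<^bsub>A\<^esub> x)"
proof (rule ring_hom_ringI2)
  show "ring A" using assms by (rule ideal.axioms)
  show "ring (quotient_algebra A I)" using assms by (rule ring_quotient_algebra)
  show "(\<lambda>x. I +>\<^bsub>A\<^esub> x) \<in> ring_hom A (quotient_algebra A I)"
    using ideal.rcos_ring_hom[OF assms] by (simp add: ring_hom_def quotient_algebra_def)
qed

lemma quotient_algebra_carrierE:
  assumes "X \<in> carrier (quotient_algebra A I)"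
  obtains x where "x \<in> carrier A" "X = I +>\<^bsub>A\<^esub> x"
  using assms by (auto simp: quotient_algebra_def FactRing_def A_RCOSETS_def')

lemma quotient_algebra_zero_iff:
  assumes "ideal I A" "x \<in> carrier A"
  shows "I +>\<^bsub>A\<^esub> x = \<zero>\<^bsub>quotient_algebra A I\<^esub> \<longleftrightarrow> x \<in> I"
proof -
  interpret ideal I A by fact
  have "I +>\<^bsub>A\<^esub> x = I \<longleftrightarrow> x \<in> I"
    using a_rcos_const[of x] a_rcos_self[OF assms(2)] by auto
  then show ?thesis by (simp add: quotient_algebra_def FactRing_def)
qed

lemma closed_ideal_generated:
  assumes "ring A" "S \<subseteq> carrier A"
  shows "closed_ideal A (generated_closed_ideal A S)" and "S \<subseteq> generated_closed_ideal A S"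
proof -
  interpret ring A by fact
  let ?F = "{I. closed_ideal A I \<and> S \<subseteq> I}"
  show "S \<subseteq> generated_closed_ideal A S"
    by (auto simp: generated_closed_ideal_def)
  have "carrier A \<in> ?F"
    using assms(2) by (simp add: closed_ideal_def oneideal)
  then have ideal: "ideal (\<Inter>?F) A"
    by (intro i_Intersect) (auto simp: closed_ideal_def)
  have closed: "x \<in> \<Inter>?F"
    if "x \<in> carrier A" "\<forall>e>0. \<exists>y\<in>\<Inter>?F. nrm A (x \<ominus>\<^bsub>A\<^esub> y) < e" for x
  proof
    fix I assume I: "I \<in> ?F"
    then have "\<Inter>?F \<subseteq> I" by (rule Inter_lower)
    then have "\<forall>e>0. \<exists>y\<in>I. nrm A (x \<ominus>\<^bsub>A\<^esub> y) < e"
      using that(2) by (meson subsetD)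
    with I that(1) show "x \<in> I" by (simp add: closed_ideal_def)
  qed
  show "closed_ideal A (generated_closed_ideal A S)"
    unfolding generated_closed_ideal_def closed_ideal_def[of A "\<Inter>?F"]
    by (intro conjI ballI impI ideal closed)
qed

section \<open>The free *-algebra\<close>

lemma free_star_algebra_induct [case_names scalar letter add mult]:
  assumes scalar: "\<And>c. P (Poly_Mapping.single 0 c)"
    and letter: "\<And>a. P (Poly_Mapping.single (Word [a]) 1)"
    and add: "\<And>x y. P x \<Longrightarrow> P y \<Longrightarrow> P (x + y)"
    and mult: "\<And>x y. P x \<Longrightarrow> P y \<Longrightarrow> P (x * y)"
  shows "P (x :: 'g free_star_algebra)"
proof -
  have word: "P (Poly_Mapping.single (Word as) 1)" for as
  proof (induction as)
    case Nil
    then show ?case using scalar[of 1] by (simp add: zero_star_word_def)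
  next
    case (Cons a as)
    have "Poly_Mapping.single (Word (a # as)) (1::complex) =
        Poly_Mapping.single (Word [a]) 1 * Poly_Mapping.single (Word as) 1"
      by (simp add: mult_single plus_star_word_def)
    then show ?case using mult[OF letter Cons.IH] by simp
  qed
  have single: "P (Poly_Mapping.single w c)" for w c
    using mult[OF scalar[of c] word[of "letters w"]] by (cases w) (simp add: mult_single)
  have sum: "P (\<Sum>w\<in>S. Poly_Mapping.single w (f w))" for S f
    by (induction S rule: infinite_finite_induct) (use scalar[of 0] in \<open>auto intro: add single\<close>)
  have "x = (\<Sum>w\<in>Poly_Mapping.keys x. Poly_Mapping.single w (Poly_Mapping.lookup x w))"
    by (rule poly_mapping_eqI) (auto simp: lookup_sum lookup_single when_def in_keys_iff)
  with sum show ?thesis by metis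
qed

lemma scalar_central:
  "Poly_Mapping.single 0 c * x = x * (Poly_Mapping.single 0 c :: 'g free_star_algebra)"
proof (induction x rule: free_star_algebra_induct)
  case (mult x y)
  have "Poly_Mapping.single 0 c * (x * y) = x * Poly_Mapping.single 0 c * y"
    by (simp only: mult.IH(1) mult.assoc[symmetric])
  then show ?case by (simp only: mult.IH(2) mult.assoc)
next
  case (scalar d)
  show ?case by (simp add: mult_single mult.commute[of c d])
qed (simp_all add: mult_single distrib_left distrib_right)

section \<open>The universal algebra of magic unitaries\<close>

abbreviation magic_cauchy ::
  "(nat \<Rightarrow> ('v::finite \<times> 'v) free_star_algebra) normed_star_algebra" where
  "magic_cauchy \<equiv> cauchy_algebra (universal_seminorm magic_relations)"

lemma A_s_eq: "A_s = quotient_algebra magic_cauchy (null_ideal magic_cauchy)"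
  by (simp add: A_s_def universal_cstar_algebra_def Let_def)

definition A_s_class :: "(nat \<Rightarrow> ('v::finite \<times> 'v) free_star_algebra) \<Rightarrow> 'v magic_element" where
  "A_s_class s = null_ideal magic_cauchy +>\<^bsub>magic_cauchy\<^esub> s"

lemma magic_gen_eq: "magic_gen i j = A_s_class (\<lambda>n. free_gen (i, j))"
  by (simp add: magic_gen_def universal_gen_def A_s_class_def Let_def)

lemma magic_cauchy_simps:
  "carrier magic_cauchy = {s. cauchy_for (universal_seminorm magic_relations) s}"
  "s \<oplus>\<^bsub>magic_cauchy\<^esub> t = (\<lambda>n. s n + t n)"
  "s \<otimes>\<^bsub>magic_cauchy\<^esub> t = (\<lambda>n. s n * t n)"
  "\<one>\<^bsub>magic_cauchy\<^esub> = (\<lambda>n. 1)"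
  "\<zero>\<^bsub>magic_cauchy\<^esub> = (\<lambda>n. 0)"
  "c \<odot>\<^bsub>magic_cauchy\<^esub> s = (\<lambda>n. free_scale c (s n))"
  "nrm magic_cauchy s = lim (\<lambda>n. universal_seminorm magic_relations (s n))"
  by (simp_all add: cauchy_algebra_def)

lemma ideal_null_magic: "ideal (null_ideal magic_cauchy) magic_cauchy"
  by (rule ideal_null_ideal[OF cstar_seminorm_magic])

lemma const_in_magic_cauchy: "(\<lambda>n. x) \<in> carrier magic_cauchy"
  by (simp add: magic_cauchy_simps cauchy_for_const[OF cstar_seminorm_magic])

lemma A_s_class_hom: "ring_hom_ring magic_cauchy A_s A_s_class"
  using quotient_algebra_hom[OF ideal_null_magic] by (simp add: A_s_eq A_s_class_def[abs_def])

lemma A_s_carrierE: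
  assumes "X \<in> carrier A_s"
  obtains s where "s \<in> carrier magic_cauchy" "X = A_s_class s"
  using quotient_algebra_carrierE[OF assms[unfolded A_s_eq]] unfolding A_s_class_def .

lemma A_s_class_zero:
  fixes r :: "('v::finite \<times> 'v) free_star_algebra"
  assumes "r \<in> magic_relations"
  shows "A_s_class (\<lambda>n. r) = \<zero>\<^bsub>A_s\<^esub>"
proof -
  have "universal_seminorm magic_relations r = 0"
    using universal_seminorm_greatest(1)[OF bounded_magic_relations[where 'v = 'v]] assms
    by (simp add: relation_seminorms_def)
  then have "(\<lambda>n. r) \<in> null_ideal magic_cauchy"
    using const_in_magic_cauchy[of r] by (simp add: null_ideal_def magic_cauchy_simps)
  then show ?thesis
    using quotient_algebra_zero_iff[OF ideal_null_magic const_in_magic_cauchy[of r]]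
    by (simp add: A_s_eq A_s_class_def)
qed

lemma adjacency_matrix_smult:
  assumes "X \<in> carrier A_s"
  shows "adjacency_matrix E i k \<odot>\<^bsub>A_s\<^esub> X = (if E i k then X else \<zero>\<^bsub>A_s\<^esub>)"
proof -
  let ?N = "null_ideal magic_cauchy :: (nat \<Rightarrow> ('a \<times> 'a) free_star_algebra) set"
  interpret N: ideal ?N magic_cauchy by (rule ideal_null_magic)
  obtain s where s: "s \<in> carrier magic_cauchy" "X = ?N +>\<^bsub>magic_cauchy\<^esub> s"
    using A_s_carrierE[OF assms] unfolding A_s_class_def by blast
  have "s \<in> X" using s by (simp add: N.a_rcos_self)
  have "?N +>\<^bsub>magic_cauchy\<^esub> x = X" if "x \<in> X" for x
    using that s by (metis N.a_repr_independence')
  then have "(\<Union>x\<in>X. ?N +>\<^bsub>magic_cauchy\<^esub> x) = X"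
    using \<open>s \<in> X\<close> by blast
  moreover have "?N +>\<^bsub>magic_cauchy\<^esub> (\<lambda>n. 0) = ?N"
    using N.a_rcos_const[OF additive_subgroup.zero_closed[OF N.is_additive_subgroup]] by (simp add: magic_cauchy_simps)
  ultimately show ?thesis
    using \<open>s \<in> X\<close>
    by (auto simp: A_s_eq quotient_algebra_def FactRing_def magic_cauchy_simps
        adjacency_matrix_def free_scale_def)
qed

text \<open>A Cauchy sequence is the limit in the universal algebra of the constant sequences formed from its
  entries, because the quotient norm of \<open>q - q M\<close> is at most the limit of the seminorms of \<open>q m - q M\<close>.
  Hence a closed ideal that contains the class of each entry contains the class of the sequence.\<close>

lemma closed_ideal_limit:
  assumes I: "closed_ideal A_s I" and q: "q \<in> carrier magic_cauchy"
    and in_I: "\<And>n. A_s_class (\<lambda>_. q n) \<in> I"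
  shows "A_s_class q \<in> I"
proof -
  let ?p = "universal_seminorm magic_relations"
  interpret h: ring_hom_ring magic_cauchy A_s A_s_class by (rule A_s_class_hom)
  interpret N: ideal "null_ideal magic_cauchy" magic_cauchy by (rule ideal_null_magic)
  have "\<exists>y\<in>I. nrm A_s (A_s_class q \<ominus>\<^bsub>A_s\<^esub> y) < e" if "e > 0" for e :: real
  proof -
    from q \<open>e > 0\<close> obtain M where M: "\<And>m n. m \<ge> M \<Longrightarrow> n \<ge> M \<Longrightarrow> ?p (q m - q n) < e / 2"
      unfolding magic_cauchy_simps mem_Collect_eq cauchy_for_def by (meson half_gt_zero)
    define r where "r = q \<ominus>\<^bsub>magic_cauchy\<^esub> (\<lambda>_. q M)"
    have r: "r \<in> carrier magic_cauchy"
      unfolding r_def using q const_in_magic_cauchy by (rule h.R.minus_closed)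
    have "\<ominus>\<^bsub>magic_cauchy\<^esub> (\<lambda>_. q M) = (\<lambda>_. - q M)"
      using const_in_magic_cauchy by (intro h.R.minus_equality) (auto simp: magic_cauchy_simps(2,5))
    then have r_eq: "r = (\<lambda>m. q m - q M)"
      by (simp add: r_def a_minus_def magic_cauchy_simps(2))
    have lim: "(\<lambda>n. ?p (s n)) \<longlonglongrightarrow> nrm magic_cauchy s" if "s \<in> carrier magic_cauchy" for s
      using cauchy_for_convergent[OF cstar_seminorm_magic] that by (simp add: magic_cauchy_simps)
    have nonneg: "0 \<le> nrm magic_cauchy s" if "s \<in> carrier magic_cauchy" for s
      by (rule LIMSEQ_le_const[OF lim[OF that]]) (simp add: cstar_seminorm_nonneg[OF cstar_seminorm_magic])
    have "nrm A_s (A_s_class r) = (INF s\<in>A_s_class r. nrm magic_cauchy s)"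
      by (simp add: A_s_eq quotient_algebra_def)
    also have "\<dots> \<le> nrm magic_cauchy r"
    proof (rule cINF_lower)
      show "r \<in> A_s_class r" unfolding A_s_class_def using r by (rule N.a_rcos_self)
      have "s \<in> carrier magic_cauchy" if "s \<in> A_s_class r" for s
        using that r N.a_elemrcos_carrier unfolding A_s_class_def by blast
      then show "bdd_below (nrm magic_cauchy ` A_s_class r)"
        by (intro bdd_belowI2[where m = 0]) (rule nonneg)
    qed
    also have "\<dots> \<le> e / 2"
      by (rule LIMSEQ_le_const2[OF lim[OF r]]) (use M in \<open>auto simp: r_eq intro!: exI[of _ M] less_imp_le\<close>)
    also have "\<dots> < e" using \<open>e > 0\<close> by simp
    also have "A_s_class r = A_s_class q \<ominus>\<^bsub>A_s\<^esub> A_s_class (\<lambda>_. q M)"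
      using q const_in_magic_cauchy[of "q M"] by (simp add: r_def a_minus_def)
    finally show ?thesis using in_I by blast
  qed
  with I q show ?thesis unfolding closed_ideal_def by (meson h.hom_closed)
qed

section \<open>The quantum automorphism algebra\<close>

definition qaut_ideal :: "('v::finite \<Rightarrow> 'v \<Rightarrow> bool) \<Rightarrow> 'v magic_element set" where
  "qaut_ideal E = generated_closed_ideal A_s (commutation_relations E)"

lemma quantum_automorphism_algebra_eq:
  "quantum_automorphism_algebra E = quotient_algebra A_s (qaut_ideal E)"
  by (simp add: quantum_automorphism_algebra_def qaut_ideal_def)

lemma commutation_relations_closed: "commutation_relations (E :: 'v::finite \<Rightarrow> 'v \<Rightarrow> bool) \<subseteq> carrier A_s"
proof -
  interpret ring "A_s :: 'v magic_element normed_star_algebra" by (rule ring_A_s)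
  have "(\<Oplus>\<^bsub>A_s\<^esub>k\<in>UNIV. c k \<odot>\<^bsub>A_s\<^esub> magic_gen (f k) (g k)) \<in> carrier A_s"
    for c and f g :: "'v \<Rightarrow> 'v"
    by (rule finsum_closed) (auto intro: smult_A_s_carrier magic_gen_carrier)
  note closed = minus_closed[OF this this]
  show ?thesis
  proof
    fix X assume "X \<in> commutation_relations E"
    then obtain i j where "X = (\<Oplus>\<^bsub>A_s\<^esub>k\<in>UNIV. adjacency_matrix E i k \<odot>\<^bsub>A_s\<^esub> magic_gen k j)
        \<ominus>\<^bsub>A_s\<^esub> (\<Oplus>\<^bsub>A_s\<^esub>k\<in>UNIV. adjacency_matrix E k j \<odot>\<^bsub>A_s\<^esub> magic_gen i k)"
      unfolding commutation_relations_def Let_def by (elim CollectE exE conjE)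
    then show "X \<in> carrier A_s" by (simp only: closed)
  qed
qed

lemma closed_qaut_ideal: "closed_ideal A_s (qaut_ideal E)"
  and commutation_relations_in_qaut_ideal: "commutation_relations E \<subseteq> qaut_ideal E"
  unfolding qaut_ideal_def by (rule closed_ideal_generated[OF ring_A_s commutation_relations_closed])+

lemma ideal_qaut_ideal: "ideal (qaut_ideal E) A_s"
  using closed_qaut_ideal[of E] by (simp add: closed_ideal_def)

definition qaut_class :: "('v::finite \<Rightarrow> 'v \<Rightarrow> bool) \<Rightarrow> ('v \<times> 'v) free_star_algebra \<Rightarrow> 'v magic_element set" where
  "qaut_class E x = qaut_ideal E +>\<^bsub>A_s\<^esub> A_s_class (\<lambda>n. x)"

text \<open>The name \<open>A\<close> stands for the quantum automorphism algebra of \<open>E\<close>; the variable makes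
  its operations available in infix notation.\<close>

context
  fixes E :: "'v::finite \<Rightarrow> 'v \<Rightarrow> bool" and A :: "'v magic_element set normed_star_algebra" (structure)
  assumes A_eq: "A = quotient_algebra A_s (qaut_ideal E)"
begin

interpretation A: ring A
  unfolding A_eq by (rule ring_quotient_algebra[OF ideal_qaut_ideal])

interpretation h: ring_hom_ring magic_cauchy A_s "A_s_class :: _ \<Rightarrow> 'v magic_element"
  by (rule A_s_class_hom)

interpretation k: ring_hom_ring A_s A "\<lambda>X. qaut_ideal E +>\<^bsub>A_s\<^esub> X"
  unfolding A_eq by (rule quotient_algebra_hom[OF ideal_qaut_ideal])

lemma qaut_class_closed [simp]: "qaut_class E x \<in> carrier A"
  by (simp add: qaut_class_def const_in_magic_cauchy)

lemma qaut_class_add: "qaut_class E (x + y) = qaut_class E x \<oplus> qaut_class E y"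
  using h.hom_add[OF const_in_magic_cauchy[of x] const_in_magic_cauchy[of y]]
  by (simp add: qaut_class_def const_in_magic_cauchy magic_cauchy_simps(2))

lemma qaut_class_mult: "qaut_class E (x * y) = qaut_class E x \<otimes> qaut_class E y"
  using h.hom_mult[OF const_in_magic_cauchy[of x] const_in_magic_cauchy[of y]]
  by (simp add: qaut_class_def const_in_magic_cauchy magic_cauchy_simps(3))

lemma qaut_class_one: "qaut_class E 1 = \<one>"
  using h.hom_one by (simp add: qaut_class_def magic_cauchy_simps(4))

lemma qaut_class_zero: "qaut_class E 0 = \<zero>"
  using h.hom_zero by (simp add: qaut_class_def magic_cauchy_simps(5))

lemma qaut_class_sum: "qaut_class E (\<Sum>i\<in>S. f i) = (\<Oplus>i\<in>S. qaut_class E (f i))"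
  by (induction S rule: infinite_finite_induct) (simp_all add: qaut_class_add qaut_class_zero)

lemma qaut_class_relation: "r \<in> magic_relations \<Longrightarrow> qaut_class E r = \<zero>"
  by (simp add: qaut_class_def A_s_class_zero)

lemma qaut_class_eqI:
  assumes "x - y \<in> magic_relations"
  shows "qaut_class E x = qaut_class E y"
  using qaut_class_add[of "x - y" y] qaut_class_relation[OF assms] by simp

lemma qaut_class_intertwines:
  "(\<Oplus>k\<in>{k. E i k}. qaut_class E (free_gen (k, j))) = (\<Oplus>k\<in>{k. E k j}. qaut_class E (free_gen (i, k)))"
proof -
  let ?h = "\<lambda>X. qaut_ideal E +>\<^bsub>A_s\<^esub> X" and ?d = "adjacency_matrix E"
  have gen: "?h (magic_gen i j) = qaut_class E (free_gen (i, j))" for i j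
    by (simp add: qaut_class_def magic_gen_eq)
  have sum: "?h (\<Oplus>\<^bsub>A_s\<^esub>k\<in>UNIV. ?d (a k) (b k) \<odot>\<^bsub>A_s\<^esub> magic_gen (f k) (g k)) =
      (\<Oplus>k\<in>{k. E (a k) (b k)}. qaut_class E (free_gen (f k, g k)))" for a b f g :: "'v \<Rightarrow> 'v"
  proof -
    have "?h (\<Oplus>\<^bsub>A_s\<^esub>k\<in>UNIV. ?d (a k) (b k) \<odot>\<^bsub>A_s\<^esub> magic_gen (f k) (g k)) =
        (\<Oplus>k\<in>UNIV. ?h (?d (a k) (b k) \<odot>\<^bsub>A_s\<^esub> magic_gen (f k) (g k)))"
      using k.hom_of_finsum[of UNIV "\<lambda>k. ?d (a k) (b k) \<odot>\<^bsub>A_s\<^esub> magic_gen (f k) (g k)"]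
      by (simp add: smult_A_s_carrier magic_gen_carrier)
    also have "\<dots> = (\<Oplus>k\<in>UNIV. if E (a k) (b k) then qaut_class E (free_gen (f k, g k)) else \<zero>)"
      by (intro A.add.finprod_cong') (auto simp: adjacency_matrix_smult magic_gen_carrier gen)
    also have "\<dots> = (\<Oplus>k\<in>{k. E (a k) (b k)}. qaut_class E (free_gen (f k, g k)))"
      by (intro A.add.finprod_mono_neutral_cong_right) auto
    finally show ?thesis .
  qed
  let ?x = "\<Oplus>\<^bsub>A_s\<^esub>k\<in>UNIV. ?d i k \<odot>\<^bsub>A_s\<^esub> magic_gen k j"
    and ?y = "\<Oplus>\<^bsub>A_s\<^esub>k\<in>UNIV. ?d k j \<odot>\<^bsub>A_s\<^esub> magic_gen i k"
  have xy: "?x \<in> carrier A_s" "?y \<in> carrier A_s"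
    by (auto intro!: h.S.finsum_closed smult_A_s_carrier magic_gen_carrier)
  have "?x \<ominus>\<^bsub>A_s\<^esub> ?y \<in> commutation_relations E"
    unfolding commutation_relations_def Let_def by (intro CollectI exI[of _ i] exI[of _ j] conjI refl TrueI)
  then have "?x \<ominus>\<^bsub>A_s\<^esub> ?y \<in> qaut_ideal E"
    by (rule subsetD[OF commutation_relations_in_qaut_ideal])
  then have "?h (?x \<ominus>\<^bsub>A_s\<^esub> ?y) = \<zero>"
    using quotient_algebra_zero_iff[OF ideal_qaut_ideal h.S.minus_closed[OF xy]] by (simp add: A_eq)
  then have "?h ?x \<ominus> ?h ?y = \<zero>" using xy by (simp add: a_minus_def)
  then have "?h ?x = ?h ?y"
    using A.r_right_minus_eq[OF k.hom_closed[OF xy(1)] k.hom_closed[OF xy(2)]] by simp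
  then show ?thesis unfolding sum .
qed

lemma graph_magic_unitary_qaut: "graph_magic_unitary A (\<lambda>i j. qaut_class E (free_gen (i, j))) E"
proof
  fix i j k :: 'v
  let ?g = "\<lambda>i j. free_gen (i, j) :: ('v \<times> 'v) free_star_algebra"
  let ?u = "\<lambda>i j. qaut_class E (?g i j)"
  have "?g i j * ?g i j - ?g i j \<in> magic_relations"
    by (auto simp: magic_relations_def Let_def)
  then show "?u i j \<otimes> ?u i j = ?u i j"
    unfolding qaut_class_mult[symmetric] by (rule qaut_class_eqI)
  show "?u i j \<otimes> ?u i k = \<zero>" if "j \<noteq> k"
  proof -
    have "?g i j * ?g i k \<in> magic_relations"
      using that by (auto simp: magic_relations_def Let_def)
    then show ?thesis unfolding qaut_class_mult[symmetric] by (rule qaut_class_relation)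
  qed
  show "?u i k \<otimes> ?u j k = \<zero>" if "i \<noteq> j"
  proof -
    have "?g i k * ?g j k \<in> {?g i k * ?g j k | i j k. i \<noteq> j}"
      using that by (intro CollectI exI[of _ i] exI[of _ j] exI[of _ k] conjI refl)
    then have "?g i k * ?g j k \<in> magic_relations"
      unfolding magic_relations_def Let_def by (intro UnI1 UnI2)
    then show ?thesis unfolding qaut_class_mult[symmetric] by (rule qaut_class_relation)
  qed
  have "(\<Sum>k\<in>UNIV. ?g i k) - 1 \<in> magic_relations"
    by (auto simp: magic_relations_def Let_def)
  then show "(\<Oplus>k\<in>UNIV. ?u i k) = \<one>"
    unfolding qaut_class_sum[symmetric] qaut_class_one[symmetric] by (rule qaut_class_eqI)
qed (simp_all add: qaut_class_intertwines)

lemma qaut_class_adj: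
  "qaut_class E (Poly_Mapping.single (Word [Adj (i, j)]) 1) = qaut_class E (free_gen (i, j))"
  unfolding free_star_gen[symmetric] by (rule qaut_class_eqI) (auto simp: magic_relations_def Let_def)

text \<open>The *-polynomials whose class commutes with a given class form a subalgebra, so the induction
  principle for *-polynomials can be used once in each factor.\<close>

lemma qaut_class_commute:
  assumes gens: "\<And>i j k l. qaut_class E (free_gen (i, j)) \<otimes> qaut_class E (free_gen (k, l)) =
      qaut_class E (free_gen (k, l)) \<otimes> qaut_class E (free_gen (i, j))"
  shows "qaut_class E x \<otimes> qaut_class E y = qaut_class E y \<otimes> qaut_class E x"
proof -
  have centralizer: "qaut_class E x \<otimes> Z = Z \<otimes> qaut_class E x"
    if Z: "Z \<in> range (qaut_class E)"
      and *: "\<And>i j. qaut_class E (free_gen (i, j)) \<otimes> Z = Z \<otimes> qaut_class E (free_gen (i, j))" for Z x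
  proof (induction x rule: free_star_algebra_induct)
    case (scalar c)
    from Z show ?case by (auto simp: scalar_central simp flip: qaut_class_mult)
  next
    case (letter a)
    show ?case
    proof (cases a)
      case (Gen g)
      with *[of "fst g" "snd g"] show ?thesis by (simp add: free_gen_def)
    next
      case (Adj g)
      with *[of "fst g" "snd g"] qaut_class_adj[of "fst g" "snd g"] show ?thesis by simp
    qed
  next
    case (add x y)
    with Z show ?case by (auto simp: qaut_class_add A.l_distr A.r_distr)
  next
    case (mult x y)
    have "Z \<in> carrier A" using Z by auto
    have "qaut_class E (x * y) \<otimes> Z = qaut_class E x \<otimes> (qaut_class E y \<otimes> Z)"
      using \<open>Z \<in> carrier A\<close> by (simp add: qaut_class_mult A.m_assoc)
    also have "\<dots> = (qaut_class E x \<otimes> Z) \<otimes> qaut_class E y"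
      using \<open>Z \<in> carrier A\<close> by (simp only: mult.IH(2) A.m_assoc qaut_class_closed)
    also have "\<dots> = Z \<otimes> qaut_class E (x * y)"
      using \<open>Z \<in> carrier A\<close> by (simp only: mult.IH(1) qaut_class_mult A.m_assoc qaut_class_closed)
    finally show ?case .
  qed
  have "qaut_class E y \<otimes> qaut_class E (free_gen (i, j)) =
      qaut_class E (free_gen (i, j)) \<otimes> qaut_class E y" for i j
    by (rule centralizer[OF rangeI]) (rule gens)
  then show ?thesis
    using centralizer[OF rangeI, of y x] by metis
qed

text \<open>Density of the *-polynomials: the commutator \<open>q\<close> of two Cauchy sequences has all its entries in the
  kernel of the class map, so its own class lies in the closed ideal that is divided out.\<close>

lemma commutative_if_generators_commute:
  assumes gens: "\<And>i j k l. qaut_class E (free_gen (i, j)) \<otimes> qaut_class E (free_gen (k, l)) =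
      qaut_class E (free_gen (k, l)) \<otimes> qaut_class E (free_gen (i, j))"
    and "X \<in> carrier A" "Y \<in> carrier A"
  shows "X \<otimes> Y = Y \<otimes> X"
proof -
  obtain \<xi> where \<xi>: "\<xi> \<in> carrier A_s" "X = qaut_ideal E +>\<^bsub>A_s\<^esub> \<xi>"
    using quotient_algebra_carrierE[OF assms(2)[unfolded A_eq]] .
  obtain \<zeta> where \<zeta>: "\<zeta> \<in> carrier A_s" "Y = qaut_ideal E +>\<^bsub>A_s\<^esub> \<zeta>"
    using quotient_algebra_carrierE[OF assms(3)[unfolded A_eq]] .
  obtain s where s: "s \<in> carrier magic_cauchy" and s_class: "\<xi> = A_s_class s"
    using A_s_carrierE[OF \<xi>(1)] .
  obtain t where t: "t \<in> carrier magic_cauchy" and t_class: "\<zeta> = A_s_class t"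
    using A_s_carrierE[OF \<zeta>(1)] .
  note X = \<xi>(2)[unfolded s_class] and Y = \<zeta>(2)[unfolded t_class]
  define q where "q = s \<otimes>\<^bsub>magic_cauchy\<^esub> t \<ominus>\<^bsub>magic_cauchy\<^esub> t \<otimes>\<^bsub>magic_cauchy\<^esub> s"
  have q: "q \<in> carrier magic_cauchy"
    unfolding q_def using s t by simp
  have ts: "t \<otimes>\<^bsub>magic_cauchy\<^esub> s \<in> carrier magic_cauchy" using s t by simp
  then have "(\<lambda>n. - (t n * s n)) \<in> carrier magic_cauchy"
    by (simp add: magic_cauchy_simps cauchy_for_uminus[OF cstar_seminorm_magic])
  with ts have "\<ominus>\<^bsub>magic_cauchy\<^esub> (t \<otimes>\<^bsub>magic_cauchy\<^esub> s) = (\<lambda>n. - (t n * s n))"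
    by (intro h.R.minus_equality) (auto simp: magic_cauchy_simps(2,3,5))
  then have q_eq: "q = (\<lambda>n. s n * t n - t n * s n)"
    by (simp add: q_def a_minus_def magic_cauchy_simps(2,3))
  have "A_s_class (\<lambda>_. q n) \<in> qaut_ideal E" for n
  proof -
    have "qaut_class E (s n * t n - t n * s n) \<oplus> qaut_class E (t n * s n) = qaut_class E (s n * t n)"
      by (simp flip: qaut_class_add)
    also have "\<dots> = qaut_class E (t n * s n)"
      unfolding qaut_class_mult by (rule qaut_class_commute[OF gens])
    finally have "qaut_class E (q n) = \<zero>"
      by (simp add: q_eq)
    then show ?thesis
      using quotient_algebra_zero_iff[OF ideal_qaut_ideal, of "A_s_class (\<lambda>_. q n)" E]
      by (simp add: qaut_class_def A_eq const_in_magic_cauchy)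
  qed
  then have "A_s_class q \<in> qaut_ideal E"
    by (rule closed_ideal_limit[OF closed_qaut_ideal q])
  then have "qaut_ideal E +>\<^bsub>A_s\<^esub> A_s_class q = \<zero>"
    using quotient_algebra_zero_iff[OF ideal_qaut_ideal h.hom_closed[OF q]] by (simp add: A_eq)
  then have "X \<otimes> Y \<ominus> Y \<otimes> X = \<zero>"
    using s t by (simp add: q_def X Y a_minus_def)
  then show ?thesis
    using A.r_right_minus_eq[OF A.m_closed[OF assms(2,3)] A.m_closed[OF assms(3,2)]] by simp
qed

end

lemma no_quantum_symmetry_if_separates_types:
  assumes "\<And>i j. E i j = E j i" "separates_types E"
  shows "no_quantum_symmetry E"
  unfolding no_quantum_symmetry_def Let_def quantum_automorphism_algebra_eq
proof (intro ballI)
  fix X Y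
  assume XY: "X \<in> carrier (quotient_algebra A_s (qaut_ideal E))" "Y \<in> carrier (quotient_algebra A_s (qaut_ideal E))"
  interpret graph_magic_unitary "quotient_algebra A_s (qaut_ideal E)" "\<lambda>i j. qaut_class E (free_gen (i, j))" E
    by (rule graph_magic_unitary_qaut[OF refl])
  show "X \<otimes>\<^bsub>quotient_algebra A_s (qaut_ideal E)\<^esub> Y = Y \<otimes>\<^bsub>quotient_algebra A_s (qaut_ideal E)\<^esub> X"
    using entries_commute[OF assms] by (rule commutative_if_generators_commute[OF refl _ XY])
qed

theorem theorem7p4:
  shows "no_quantum_symmetry C13_3_4"
proof (rule no_quantum_symmetry_if_separates_types)
  show "C13_3_4 i j = C13_3_4 j i" for i j
    by (rule iffI[OF C13_3_4_simple_graph(1) C13_3_4_simple_graph(1)])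
qed (rule separates_types_C13_3_4)

end
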